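(* The proof system $\mathsf{BBP}$ is complete with respect to the bisimulation semantics of star expressions (without $1$ and with binary Kleene star): for all star expressions $e_1,e_2$ over a set $A$ of actions, if the chart interpretations $\mathcal{C}(e_1)$ and $\mathcal{C}(e_2)$ are bisimilar, then $e_1 = e_2$ is derivable in $\mathsf{BBP}$.
   Context: **Star expressions.** Given a set $A$ of actions, the set $StExp(A)$ of star expressions over $A$ is generated by $e ::= 0 \mid a \mid (e_1+e_2) \mid (e_1\cdot e_2) \mid (e_1^{\circledast} e_2)$ with $a\in A$ (there is no constant $1$; $^{\circledast}$ is the binary Kleene star). **Charts.** A chart is a tuple $\langle V,\sqrt{},v_s,A,T\rangle$ with $V$ a finite set of vertices; $\sqrt{}$ a special symbol which, if $\sqrt{}\in V$, is a vertex without outgoing transitions indicating termination; $v_s\in V\setminus\{\sqrt{}\}$ the start vertex; $T\subseteq V\times A\times V$ a finite set of transitions, written $v\xrightarrow{a}v'$. Every vertex is reachable from $v_s$. **Bisimilarity.** A bisimulation between charts $\mathcal{C}_1,\mathcal{C}_2$ with vertex sets $V_1,V_2$ is a relation $B\subseteq V_1\times V_2$ that relates the start vertices and such that whenever $v_1\,B\,v_2$: for every $v_1\xrightarrow{a}v_1'$ there is $v_2\xrightarrow{a}v_2'$ with $v_1'\,B\,v_2'$; for every $v_2\xrightarrow{a}v_2'$ there is $v_1\xrightarrow{a}v_1'$ with $v_1'\,B\,v_2'$; and $v_1=\sqrt{}$ iff $v_2=\sqrt{}$. Charts are bisimilar if there is a bisimulation between them. **Chart interpretation.** $\mathcal{C}(e)$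 is the chart with start vertex $e$ whose vertices are the elements of $StExp(A)\cup\{\sqrt{}\}$ reachable from $e$, with transitions defined by the following rules ($\xi\in StExp(A)\cup\{\sqrt{}\}$, $e_1'\in StExp(A)$): $a\xrightarrow{a}\sqrt{}$; if $e_i\xrightarrow{a}\xi$ for some $i\in\{1,2\}$ then $e_1+e_2\xrightarrow{a}\xi$; if $e_1\xrightarrow{a}e_1'$ then $e_1\cdot e_2\xrightarrow{a}e_1'\cdot e_2$; if $e_1\xrightarrow{a}\sqrt{}$ then $e_1\cdot e_2\xrightarrow{a}e_2$; if $e_1\xrightarrow{a}e_1'$ then $e_1^{\circledast}e_2\xrightarrow{a}e_1'\cdot(e_1^{\circledast}e_2)$; if $e_1\xrightarrow{a}\sqrt{}$ then $e_1^{\circledast}e_2\xrightarrow{a}e_1^{\circledast}e_2$; if $e_2\xrightarrow{a}\xi$ then $e_1^{\circledast}e_2\xrightarrow{a}\xi$. (This chart is finite.) **The proof system $\mathsf{BBP}$** consists of the rules of equational logic (reflexivity, symmetry, transitivity, congruence, substitution instances of axioms), the axioms (B1) $x+y=y+x$; (B2) $(x+y)+z=x+(y+z)$; (B3) $x+x=x$; (B4) $(x+y)\cdot z=x\cdot z+y\cdot z$; (B5) $(x\cdot y)\cdot z=x\cdot(y\cdot z)$; (B6) $x+0=x$; (B7) $0\cdot x=0$; (BKS1) $x\cdot(x^{\circledast}y)+y=x^{\circledast}y$; (BKS2) $(x^{\circledast}y)\cdot z=x^{\circledast}(y\cdot z)$; and the rule ($\mathrm{RSP}^{\circledast}$): from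 $x=(y\cdot x)+z$ infer $x=y^{\circledast}z$. *)

theory Defs
  imports Main
begin

datatype 'a stexp =
    Zero
  | Act 'a
  | Plus "'a stexp" "'a stexp"  (infixl "\<oplus>" 65)
  | Seq "'a stexp" "'a stexp"  (infixl "\<odot>" 70)
  | Star "'a stexp" "'a stexp"  (infixl "\<star>" 75)

inductive_set StExp :: "'a set \<Rightarrow> 'a stexp set" for A :: "'a set" where
  "Zero \<in> StExp A"
| "a \<in> A \<Longrightarrow> Act a \<in> StExp A"
| "e1 \<in> StExp A \<Longrightarrow> e2 \<in> StExp A \<Longrightarrow> e1 \<oplus> e2 \<in> StExp A"
| "e1 \<in> StExp A \<Longrightarrow> e2 \<in> StExp A \<Longrightarrow> e1 \<odot> e2 \<in> StExp A"
| "e1 \<in> StExp A \<Longrightarrow> e2 \<in> StExp A \<Longrightarrow> e1 \<star> e2 \<in> StExp A"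

lemma StExp_simps [simp]:
  "Zero \<in> StExp A"
  "Act a \<in> StExp A \<longleftrightarrow> a \<in> A"
  "e1 \<oplus> e2 \<in> StExp A \<longleftrightarrow> e1 \<in> StExp A \<and> e2 \<in> StExp A"
  "e1 \<odot> e2 \<in> StExp A \<longleftrightarrow> e1 \<in> StExp A \<and> e2 \<in> StExp A"
  "e1 \<star> e2 \<in> StExp A \<longleftrightarrow> e1 \<in> StExp A \<and> e2 \<in> StExp A"
  by (auto intro: StExp.intros elim: StExp.cases)

text \<open>
  \<open>Tick\<close> is the special symbol for termination, kept apart from all ordinary
  vertices \<open>Vert v\<close> by the type. It may or may not belong to the vertex set of a chart.
\<close>

datatype 'v node = Tick | Vert 'v

record ('v, 'a) chart =
  vertices :: "'v node set"
  start :: "'v node"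
  actions :: "'a set"
  transitions :: "('v node \<times> 'a \<times> 'v node) set"

definition edges :: "('v \<times> 'a \<times> 'v) set \<Rightarrow> ('v \<times> 'v) set" where
  "edges T = {(v, w). \<exists>a. (v, a, w) \<in> T}"

definition is_chart :: "('v, 'a) chart \<Rightarrow> bool" where
  "is_chart C \<longleftrightarrow>
     finite (vertices C) \<and>
     start C \<in> vertices C - {Tick} \<and>
     finite (transitions C) \<and>
     transitions C \<subseteq> vertices C \<times> actions C \<times> vertices C \<and>
     (\<forall>a w. (Tick, a, w) \<notin> transitions C) \<and>
     (\<forall>v \<in> vertices C. (start C, v) \<in> (edges (transitions C))\<^sup>*)"

definition bisimulation ::
  "('v, 'a) chart \<Rightarrow> ('w, 'a) chart \<Rightarrow> ('v node \<times> 'w node) set \<Rightarrow> bool" where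
  "bisimulation C1 C2 B \<longleftrightarrow>
     B \<subseteq> vertices C1 \<times> vertices C2 \<and>
     (start C1, start C2) \<in> B \<and>
     (\<forall>(v1, v2) \<in> B.
        (\<forall>a v1'. (v1, a, v1') \<in> transitions C1 \<longrightarrow>
           (\<exists>v2'. (v2, a, v2') \<in> transitions C2 \<and> (v1', v2') \<in> B)) \<and>
        (\<forall>a v2'. (v2, a, v2') \<in> transitions C2 \<longrightarrow>
           (\<exists>v1'. (v1, a, v1') \<in> transitions C1 \<and> (v1', v2') \<in> B)) \<and>
        (v1 = Tick \<longleftrightarrow> v2 = Tick))"

definition bisimilar :: "('v, 'a) chart \<Rightarrow> ('w, 'a) chart \<Rightarrow> bool" where
  "bisimilar C1 C2 \<longleftrightarrow> (\<exists>B. bisimulation C1 C2 B)"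

inductive step :: "'a stexp \<Rightarrow> 'a \<Rightarrow> 'a stexp node \<Rightarrow> bool" where
  step_Act: "step (Act a) a Tick"
| step_Plus1: "step e1 a \<xi> \<Longrightarrow> step (e1 \<oplus> e2) a \<xi>"
| step_Plus2: "step e2 a \<xi> \<Longrightarrow> step (e1 \<oplus> e2) a \<xi>"
| step_Seq: "step e1 a (Vert e1') \<Longrightarrow> step (e1 \<odot> e2) a (Vert (e1' \<odot> e2))"
| step_Seq_Tick: "step e1 a Tick \<Longrightarrow> step (e1 \<odot> e2) a (Vert e2)"
| step_Star: "step e1 a (Vert e1') \<Longrightarrow> step (e1 \<star> e2) a (Vert (e1' \<odot> (e1 \<star> e2)))"
| step_Star_Tick: "step e1 a Tick \<Longrightarrow> step (e1 \<star> e2) a (Vert (e1 \<star> e2))"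
| step_Star_Exit: "step e2 a \<xi> \<Longrightarrow> step (e1 \<star> e2) a \<xi>"

definition step_rel :: "('a stexp node \<times> 'a \<times> 'a stexp node) set" where
  "step_rel = {(Vert e, a, \<xi>) | e a \<xi>. step e a \<xi>}"

definition reach :: "'a stexp \<Rightarrow> 'a stexp node set" where
  "reach e = {\<xi>. (Vert e, \<xi>) \<in> (edges step_rel)\<^sup>*}"

definition chart_of :: "'a set \<Rightarrow> 'a stexp \<Rightarrow> ('a stexp, 'a) chart" where
  "chart_of A e =
     \<lparr> vertices = reach e,
       start = Vert e,
       actions = A,
       transitions = {(v, a, w) \<in> step_rel. v \<in> reach e} \<rparr>"

lemma reach_subset:
  assumes "Vert e \<in> S" "\<And>f a \<xi>. Vert f \<in> S \<Longrightarrow> step f a \<xi> \<Longrightarrow> \<xi> \<in> S"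
  shows "reach e \<subseteq> S"
proof
  fix \<xi> assume "\<xi> \<in> reach e"
  then have "(Vert e, \<xi>) \<in> (edges step_rel)\<^sup>*" by (simp add: reach_def)
  then show "\<xi> \<in> S"
    by (induction rule: rtrancl_induct) (use assms in \<open>auto simp: edges_def step_rel_def\<close>)
qed

lemma reach_refl: "Vert e \<in> reach e"
  by (simp add: reach_def)

lemma reach_step: "Vert f \<in> reach e \<Longrightarrow> step f a \<xi> \<Longrightarrow> \<xi> \<in> reach e"
  unfolding reach_def
  by (auto simp: edges_def step_rel_def intro: rtrancl_into_rtrancl)

inductive_cases step_ZeroE: "step Zero a \<xi>"
inductive_cases step_ActE: "step (Act b) a \<xi>"
inductive_cases step_PlusE: "step (e1 \<oplus> e2) a \<xi>"
inductive_cases step_SeqE: "step (e1 \<odot> e2) a \<xi>"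
inductive_cases step_StarE: "step (e1 \<star> e2) a \<xi>"

lemma finite_Vert_image: "finite S \<Longrightarrow> finite {Vert (g f) | f. Vert f \<in> S}"
proof -
  assume "finite S"
  have "{Vert (g f) | f. Vert f \<in> S} \<subseteq> (\<lambda>x. case x of Tick \<Rightarrow> Tick | Vert f \<Rightarrow> Vert (g f)) ` S"
    by force
  with \<open>finite S\<close> show ?thesis by (meson finite_imageI finite_subset)
qed

lemma finite_reach: "finite (reach e)"
proof (induction e)
  case Zero
  have "reach Zero \<subseteq> {Vert Zero}"
    by (rule reach_subset) (auto elim: step_ZeroE)
  then show ?case by (rule finite_subset) simp
next
  case (Act b)
  have "reach (Act b) \<subseteq> {Vert (Act b), Tick}"
    by (rule reach_subset) (auto elim: step_ActE)
  then show ?case by (rule finite_subset) simp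
next
  case (Plus e1 e2)
  have "reach (e1 \<oplus> e2) \<subseteq> insert (Vert (e1 \<oplus> e2)) (reach e1 \<union> reach e2)"
    by (rule reach_subset) (auto elim!: step_PlusE intro: reach_refl reach_step reach_step[OF reach_refl])
  then show ?case by (rule finite_subset) (use Plus in simp)
next
  case (Seq e1 e2)
  have "reach (e1 \<odot> e2) \<subseteq> {Vert (f \<odot> e2) | f. Vert f \<in> reach e1} \<union> reach e2"
    by (rule reach_subset) (auto elim!: step_SeqE intro: reach_refl reach_step reach_step[OF reach_refl])
  then show ?case by (rule finite_subset) (use Seq finite_Vert_image in auto)
next
  case (Star e1 e2)
  have "reach (e1 \<star> e2) \<subseteq>
    insert (Vert (e1 \<star> e2)) ({Vert (f \<odot> (e1 \<star> e2)) | f. Vert f \<in> reach e1} \<union> reach e2)"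
    by (rule reach_subset)
      (auto elim!: step_StarE step_SeqE intro: reach_refl reach_step reach_step[OF reach_refl])
  then show ?case by (rule finite_subset) (use Star finite_Vert_image in auto)
qed

lemma step_StExp:
  "step e a \<xi> \<Longrightarrow> e \<in> StExp A \<Longrightarrow> a \<in> A \<and> (\<forall>f. \<xi> = Vert f \<longrightarrow> f \<in> StExp A)"
  by (induction rule: step.induct) auto

lemma reach_StExp: "e \<in> StExp A \<Longrightarrow> reach e \<subseteq> insert Tick (Vert ` StExp A)"
  by (rule reach_subset) (auto dest: step_StExp, metis image_eqI node.exhaust step_StExp)

lemma finite_steps: "finite {(a, \<xi>). step e a \<xi>}"
proof -
  have "finite (set_stexp e)" by (induction e) auto
  moreover have "e \<in> StExp (set_stexp e)"
  proof -
    have "set_stexp e \<subseteq> A \<Longrightarrow> e \<in> StExp A" for A by (induction e) auto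
    then show ?thesis by simp
  qed
  then have "{(a, \<xi>). step e a \<xi>} \<subseteq> set_stexp e \<times> reach e"
    using step_StExp reach_step[OF reach_refl] by fast
  ultimately show ?thesis by (meson finite_SigmaI finite_reach finite_subset)
qed

lemma is_chart_chart_of:
  assumes "e \<in> StExp A"
  shows "is_chart (chart_of A e)"
proof -
  let ?T = "{(v, a, w) \<in> step_rel. v \<in> reach e}"
  have "?T \<subseteq> (\<Union>v \<in> reach e. case v of Tick \<Rightarrow> {} | Vert f \<Rightarrow> (\<lambda>(a, \<xi>). (v, a, \<xi>)) ` {(a, \<xi>). step f a \<xi>})"
    by (force simp: step_rel_def)
  moreover have "finite \<dots>"
    by (auto simp: finite_reach finite_steps split: node.split)
  ultimately have fin: "finite ?T" by (rule finite_subset)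
  have sub: "?T \<subseteq> reach e \<times> A \<times> reach e"
    using reach_StExp[OF assms] step_StExp reach_step by (fastforce simp: step_rel_def)
  have "(Vert e, v) \<in> (edges ?T)\<^sup>*" if "v \<in> reach e" for v
  proof -
    from that have "(Vert e, v) \<in> (edges step_rel)\<^sup>*" by (simp add: reach_def)
    then show ?thesis
    proof (induction rule: rtrancl_induct)
      case (step v w)
      then have "v \<in> reach e" by (simp add: reach_def)
      with step.hyps have "(v, w) \<in> edges ?T" by (auto simp: edges_def)
      with step.IH show ?case by (rule rtrancl_into_rtrancl)
    qed simp
  qed
  with fin sub show ?thesis
    by (auto simp: is_chart_def chart_of_def finite_reach reach_refl step_rel_def)
qed

text \<open>
  All substitution instances of the axioms: \<open>x\<close>, \<open>y\<close>, \<open>z\<close> range over star expressions.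
\<close>

inductive BBP_axiom :: "'a stexp \<Rightarrow> 'a stexp \<Rightarrow> bool" where
  B1: "BBP_axiom (x \<oplus> y) (y \<oplus> x)"
| B2: "BBP_axiom ((x \<oplus> y) \<oplus> z) (x \<oplus> (y \<oplus> z))"
| B3: "BBP_axiom (x \<oplus> x) x"
| B4: "BBP_axiom ((x \<oplus> y) \<odot> z) ((x \<odot> z) \<oplus> (y \<odot> z))"
| B5: "BBP_axiom ((x \<odot> y) \<odot> z) (x \<odot> (y \<odot> z))"
| B6: "BBP_axiom (x \<oplus> Zero) x"
| B7: "BBP_axiom (Zero \<odot> x) Zero"
| BKS1: "BBP_axiom ((x \<odot> (x \<star> y)) \<oplus> y) (x \<star> y)"
| BKS2: "BBP_axiom ((x \<star> y) \<odot> z) (x \<star> (y \<odot> z))"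

text \<open>
  \<open>BBP A e f\<close>: the equation \<open>e = f\<close> has a derivation in which all star expressions are over \<open>A\<close>.
\<close>

inductive BBP :: "'a set \<Rightarrow> 'a stexp \<Rightarrow> 'a stexp \<Rightarrow> bool" for A :: "'a set" where
  Axiom: "BBP_axiom e f \<Longrightarrow> e \<in> StExp A \<Longrightarrow> f \<in> StExp A \<Longrightarrow> BBP A e f"
| Refl: "e \<in> StExp A \<Longrightarrow> BBP A e e"
| Sym: "BBP A e f \<Longrightarrow> BBP A f e"
| Trans: "BBP A e f \<Longrightarrow> BBP A f g \<Longrightarrow> BBP A e g"
| Cong_Plus: "BBP A e1 f1 \<Longrightarrow> BBP A e2 f2 \<Longrightarrow> BBP A (e1 \<oplus> e2) (f1 \<oplus> f2)"
| Cong_Seq: "BBP A e1 f1 \<Longrightarrow> BBP A e2 f2 \<Longrightarrow> BBP A (e1 \<odot> e2) (f1 \<odot> f2)"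
| Cong_Star: "BBP A e1 f1 \<Longrightarrow> BBP A e2 f2 \<Longrightarrow> BBP A (e1 \<star> e2) (f1 \<star> f2)"
| RSP: "BBP A x ((y \<odot> x) \<oplus> z) \<Longrightarrow> BBP A x (y \<star> z)"

lemma BBP_StExp: "BBP A e f \<Longrightarrow> e \<in> StExp A \<and> f \<in> StExp A"
  by (induction rule: BBP.induct) auto

end

theory Submission
  imports Defs
begin

text \<open>
  Charts of star expressions satisfy Milner's loop existence and elimination property (LEE).
  Eliminating an edge whose continuations all return to its source \<open>v\<close> (or get stuck) turns the
  equation for \<open>v\<close> into one with a larger loop expression, by (BKS2) and (RSP), without changing
  the set of solutions. Hence a system of equations over a LEE graph has exactly one solution up
  to provable equality.

  LEE is inherited by subgraphs and by images under functional bisimulations: a path in the image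
  lifts to the original graph, and avoids the base vertex of a loop there if it does so in the
  image. So the bisimulation collapse of the charts of \<open>e\<^sub>1\<close> and \<open>e\<^sub>2\<close> has a solution; pulled back,
  it solves both charts, as do the expressions themselves, and uniqueness identifies the two.
\<close>

section \<open>Derived equations\<close>

declare BBP.Trans [trans]

lemma BBP_Star_unfold:
  assumes "BBP A x (y \<star> z)" "y \<in> StExp A" "z \<in> StExp A"
  shows "BBP A x ((y \<odot> x) \<oplus> z)"
proof -
  have "BBP A (y \<star> z) ((y \<odot> (y \<star> z)) \<oplus> z)"
    using assms by (intro BBP.Sym[OF BBP.Axiom] BKS1) auto
  also have "BBP A \<dots> ((y \<odot> x) \<oplus> z)"
    using assms by (intro BBP.Cong_Plus BBP.Cong_Seq BBP.Refl) (auto intro: BBP.Sym)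
  finally show ?thesis using assms(1) by (rule BBP.Trans[rotated])
qed

lemma BBP_Star_iff:
  assumes "y \<in> StExp A" "z \<in> StExp A"
  shows "BBP A x (y \<star> z) \<longleftrightarrow> BBP A x ((y \<odot> x) \<oplus> z)"
proof
  assume "BBP A x (y \<star> z)"
  then show "BBP A x ((y \<odot> x) \<oplus> z)" using assms by (rule BBP_Star_unfold)
next
  assume "BBP A x ((y \<odot> x) \<oplus> z)"
  then show "BBP A x (y \<star> z)" by (rule BBP.RSP)
qed

lemma BBP_cong_right:
  assumes "BBP A f g"
  shows "BBP A e f \<longleftrightarrow> BBP A e g"
proof
  show "BBP A e g" if "BBP A e f" using that assms by (rule BBP.Trans)
  show "BBP A e f" if "BBP A e g" using that BBP.Sym[OF assms] by (rule BBP.Trans)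
qed

text \<open>By (RSP) and unfolding, each side amounts to a linear equation for \<open>x\<close>; the
  two equations differ only by (B2) and (B4).\<close>

lemma BBP_Star_shift:
  assumes "x \<in> StExp A" "p \<in> StExp A" "q \<in> StExp A" "t \<in> StExp A"
  shows "BBP A x (p \<star> ((q \<odot> x) \<oplus> t)) \<longleftrightarrow> BBP A x ((p \<oplus> q) \<star> t)"
proof -
  have "BBP A ((p \<odot> x) \<oplus> ((q \<odot> x) \<oplus> t)) (((p \<odot> x) \<oplus> (q \<odot> x)) \<oplus> t)"
    using assms by (intro BBP.Sym[OF BBP.Axiom] B2) auto
  also have "BBP A \<dots> (((p \<oplus> q) \<odot> x) \<oplus> t)"
    using assms by (intro BBP.Cong_Plus BBP.Refl BBP.Sym[OF BBP.Axiom] B4) auto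
  finally have "BBP A x ((p \<odot> x) \<oplus> ((q \<odot> x) \<oplus> t)) \<longleftrightarrow> BBP A x (((p \<oplus> q) \<odot> x) \<oplus> t)"
    by (rule BBP_cong_right)
  then show ?thesis using assms by (simp add: BBP_Star_iff)
qed

lemma BBP_Plus_Zero_left: "x \<in> StExp A \<Longrightarrow> BBP A (Zero \<oplus> x) x"
  by (rule BBP.Trans[OF BBP.Axiom[OF B1] BBP.Axiom[OF B6]]) auto

text \<open>Turns a plain equation into one with an empty loop, the form required by
  \<open>solves\<close>.\<close>

lemma BBP_Zero_Star: "x \<in> StExp A \<Longrightarrow> BBP A x (Zero \<star> x)"
proof (rule BBP.RSP)
  assume x: "x \<in> StExp A"
  have "BBP A ((Zero \<odot> x) \<oplus> x) (Zero \<oplus> x)"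
    using x by (intro BBP.Cong_Plus BBP.Axiom B7 BBP.Refl) auto
  also note BBP_Plus_Zero_left[OF x]
  finally show "BBP A x ((Zero \<odot> x) \<oplus> x)" by (rule BBP.Sym)
qed

section \<open>Finite sums\<close>

text \<open>Which enumeration is chosen, repetitions included, matters only up to provable equality,
  by \<open>foldr_Plus_cong\<close>.\<close>

definition ssum :: "'a stexp set \<Rightarrow> 'a stexp" where
  "ssum S = foldr (\<oplus>) (SOME xs. set xs = S) Zero"

lemma foldr_Plus_StExp: "foldr (\<oplus>) xs Zero \<in> StExp A \<longleftrightarrow> set xs \<subseteq> StExp A"
  by (induction xs) auto

text \<open>With \<open>BBP A (x \<oplus> u) u\<close> read as the semilattice order, this is the
  least upper bound property of sums.\<close>

lemma foldr_Plus_absorb: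
  assumes "u \<in> StExp A" "\<And>x. x \<in> set xs \<Longrightarrow> BBP A (x \<oplus> u) u"
  shows "BBP A (foldr (\<oplus>) xs Zero \<oplus> u) u"
  using assms(2)
proof (induction xs)
  case Nil
  then show ?case using assms(1) by (simp add: BBP_Plus_Zero_left)
next
  case (Cons x xs)
  have IH: "BBP A (foldr (\<oplus>) xs Zero \<oplus> u) u" using Cons by simp
  have x: "BBP A (x \<oplus> u) u" using Cons by simp
  have "BBP A (foldr (\<oplus>) (x # xs) Zero \<oplus> u) (x \<oplus> (foldr (\<oplus>) xs Zero \<oplus> u))"
    using BBP_StExp[OF IH] BBP_StExp[OF x] by (simp add: BBP.Axiom[OF B2])
  also have "BBP A \<dots> (x \<oplus> u)"
    using IH BBP_StExp[OF x] by (intro BBP.Cong_Plus BBP.Refl) auto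
  also note x
  finally show ?case .
qed

lemma foldr_Plus_member:
  assumes "x \<in> set xs" "set xs \<subseteq> StExp A"
  shows "BBP A (x \<oplus> foldr (\<oplus>) xs Zero) (foldr (\<oplus>) xs Zero)"
  using assms
proof (induction xs)
  case (Cons y xs)
  let ?t = "foldr (\<oplus>) xs Zero"
  have St: "x \<in> StExp A" "y \<in> StExp A" "?t \<in> StExp A"
    using Cons.prems by (auto simp: foldr_Plus_StExp)
  have assoc: "BBP A (x \<oplus> (y \<oplus> ?t)) ((x \<oplus> y) \<oplus> ?t)"
    using St by (intro BBP.Sym[OF BBP.Axiom] B2) auto
  show ?case
  proof (cases "x = y")
    case True
    note assoc
    also have "BBP A ((x \<oplus> y) \<oplus> ?t) (y \<oplus> ?t)"
      using St True by (intro BBP.Cong_Plus BBP.Refl) (auto intro: BBP.Axiom[OF B3])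
    finally show ?thesis by simp
  next
    case False
    note assoc
    also have "BBP A ((x \<oplus> y) \<oplus> ?t) ((y \<oplus> x) \<oplus> ?t)"
      using St by (intro BBP.Cong_Plus BBP.Refl BBP.Axiom B1) auto
    also have "BBP A \<dots> (y \<oplus> (x \<oplus> ?t))"
      using St by (intro BBP.Axiom B2) auto
    also have "BBP A \<dots> (y \<oplus> ?t)"
      using Cons False St by (intro BBP.Cong_Plus BBP.Refl) auto
    finally show ?thesis by simp
  qed
qed simp

lemma foldr_Plus_le:
  assumes "set ys \<subseteq> StExp A" "\<And>x. x \<in> set xs \<Longrightarrow> \<exists>y \<in> set ys. BBP A x y"
  shows "BBP A (foldr (\<oplus>) xs Zero \<oplus> foldr (\<oplus>) ys Zero) (foldr (\<oplus>) ys Zero)"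
proof (rule foldr_Plus_absorb)
  fix x assume "x \<in> set xs"
  then obtain y where y: "y \<in> set ys" "BBP A x y" using assms by blast
  have "BBP A (x \<oplus> foldr (\<oplus>) ys Zero) (y \<oplus> foldr (\<oplus>) ys Zero)"
    using y assms(1) by (intro BBP.Cong_Plus BBP.Refl) (auto simp: foldr_Plus_StExp)
  also note foldr_Plus_member[OF y(1) assms(1)]
  finally show "BBP A (x \<oplus> foldr (\<oplus>) ys Zero) (foldr (\<oplus>) ys Zero)" .
qed (simp add: foldr_Plus_StExp assms(1))

text \<open>Antisymmetry of the semilattice order: each sum absorbs the other, and (B1) joins the
  two facts.\<close>

lemma foldr_Plus_cong:
  assumes "\<And>x. x \<in> set xs \<Longrightarrow> \<exists>y \<in> set ys. BBP A x y"
    and "\<And>y. y \<in> set ys \<Longrightarrow> \<exists>x \<in> set xs. BBP A x y"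
  shows "BBP A (foldr (\<oplus>) xs Zero) (foldr (\<oplus>) ys Zero)"
proof -
  have St: "set xs \<subseteq> StExp A" "set ys \<subseteq> StExp A"
    using assms BBP_StExp by blast+
  have "BBP A (foldr (\<oplus>) xs Zero) (foldr (\<oplus>) ys Zero \<oplus> foldr (\<oplus>) xs Zero)"
    using St assms(2) by (intro BBP.Sym[OF foldr_Plus_le]) (blast intro: BBP.Sym)+
  also have "BBP A \<dots> (foldr (\<oplus>) xs Zero \<oplus> foldr (\<oplus>) ys Zero)"
    using St by (intro BBP.Axiom B1) (auto simp: foldr_Plus_StExp)
  also have "BBP A \<dots> (foldr (\<oplus>) ys Zero)"
    using St assms by (intro foldr_Plus_le)
  finally show ?thesis .
qed

lemma ssum_list: "finite S \<Longrightarrow> \<exists>xs. set xs = S \<and> ssum S = foldr (\<oplus>) xs Zero"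
  unfolding ssum_def by (rule exI, rule conjI[OF someI_ex refl], rule finite_list)

lemma ssum_StExp: "finite S \<Longrightarrow> ssum S \<in> StExp A \<longleftrightarrow> S \<subseteq> StExp A"
  by (drule ssum_list) (elim exE conjE, simp add: foldr_Plus_StExp)

lemma ssum_cong:
  assumes "finite S" "finite T"
    and "\<And>x. x \<in> S \<Longrightarrow> \<exists>y \<in> T. BBP A x y" "\<And>y. y \<in> T \<Longrightarrow> \<exists>x \<in> S. BBP A x y"
  shows "BBP A (ssum S) (ssum T)"
proof -
  obtain xs where xs: "set xs = S" "ssum S = foldr (\<oplus>) xs Zero"
    using ssum_list[OF assms(1)] by blast
  obtain ys where ys: "set ys = T" "ssum T = foldr (\<oplus>) ys Zero"
    using ssum_list[OF assms(2)] by blast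
  show ?thesis
    unfolding xs(2) ys(2) by (rule foldr_Plus_cong; unfold xs(1) ys(1); erule assms(3,4))
qed

lemma ssum_set: "set xs \<subseteq> StExp A \<Longrightarrow> BBP A (ssum (set xs)) (foldr (\<oplus>) xs Zero)"
proof -
  assume xs: "set xs \<subseteq> StExp A"
  obtain ys where "set ys = set xs" "ssum (set xs) = foldr (\<oplus>) ys Zero"
    using ssum_list[of "set xs"] by auto
  moreover have "BBP A x x" if "x \<in> set xs" for x using that xs BBP.Refl by blast
  ultimately show ?thesis using foldr_Plus_cong[of ys xs A] by metis
qed

lemma ssum_empty: "BBP A (ssum {}) Zero"
  using ssum_set[of "[]" A] by simp

lemma ssum_insert:
  assumes "finite S" "S \<subseteq> StExp A" "x \<in> StExp A"
  shows "BBP A (ssum (insert x S)) (x \<oplus> ssum S)"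
proof -
  obtain xs where xs: "set xs = S" "ssum S = foldr (\<oplus>) xs Zero"
    using ssum_list[OF assms(1)] by blast
  show ?thesis using ssum_set[of "x # xs" A] assms xs by simp
qed

lemma ssum_Un:
  assumes "finite S" "S \<subseteq> StExp A" "finite T" "T \<subseteq> StExp A"
  shows "BBP A (ssum (S \<union> T)) (ssum S \<oplus> ssum T)"
  using assms(1,2)
proof (induction S)
  case empty
  have "BBP A (ssum T) (Zero \<oplus> ssum T)"
    using assms by (intro BBP.Sym[OF BBP_Plus_Zero_left]) (auto simp: ssum_StExp)
  also have "BBP A \<dots> (ssum {} \<oplus> ssum T)"
    using assms by (intro BBP.Cong_Plus BBP.Sym[OF ssum_empty] BBP.Refl) (auto simp: ssum_StExp)
  finally show ?case by simp
next
  case (insert x S)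
  have St: "x \<in> StExp A" "ssum S \<in> StExp A" "ssum T \<in> StExp A"
    using insert assms by (auto simp: ssum_StExp)
  have "BBP A (ssum (insert x S \<union> T)) (x \<oplus> ssum (S \<union> T))"
    using insert assms ssum_insert[of "S \<union> T" A x] by simp
  also have "BBP A \<dots> (x \<oplus> (ssum S \<oplus> ssum T))"
    using insert St by (intro BBP.Cong_Plus BBP.Refl) auto
  also have "BBP A \<dots> ((x \<oplus> ssum S) \<oplus> ssum T)"
    using St by (intro BBP.Sym[OF BBP.Axiom] B2) auto
  also have "BBP A \<dots> (ssum (insert x S) \<oplus> ssum T)"
    using insert St by (intro BBP.Cong_Plus BBP.Refl BBP.Sym[OF ssum_insert]) auto
  finally show ?case .
qed

lemma ssum_Seq:
  assumes "finite S" "S \<subseteq> StExp A" "g \<in> StExp A"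
  shows "BBP A (ssum S \<odot> g) (ssum ((\<lambda>x. x \<odot> g) ` S))"
  using assms(1,2)
proof (induction S)
  case empty
  have "BBP A (ssum {} \<odot> g) (Zero \<odot> g)"
    using assms by (intro BBP.Cong_Seq ssum_empty BBP.Refl)
  also have "BBP A \<dots> Zero" using assms by (intro BBP.Axiom B7) auto
  also have "BBP A \<dots> (ssum {})" by (rule BBP.Sym[OF ssum_empty])
  finally show ?case by simp
next
  case (insert x S)
  have St: "x \<in> StExp A" "ssum S \<in> StExp A" using insert by (auto simp: ssum_StExp)
  have "BBP A (ssum (insert x S) \<odot> g) ((x \<oplus> ssum S) \<odot> g)"
    using insert assms by (intro BBP.Cong_Seq ssum_insert BBP.Refl) auto
  also have "BBP A \<dots> ((x \<odot> g) \<oplus> (ssum S \<odot> g))"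
    using St assms by (intro BBP.Axiom B4) auto
  also have "BBP A \<dots> ((x \<odot> g) \<oplus> ssum ((\<lambda>x. x \<odot> g) ` S))"
    using insert St assms by (intro BBP.Cong_Plus BBP.Refl) auto
  also have "BBP A \<dots> (ssum (insert (x \<odot> g) ((\<lambda>x. x \<odot> g) ` S)))"
    using insert St assms by (intro BBP.Sym[OF ssum_insert]) auto
  finally show ?case by simp
qed

section \<open>Loop existence and elimination\<close>

type_synonym ('v, 'a) graph = "('v \<times> 'a \<times> 'v node) set"

text \<open>Edges are reversed so that well-foundedness excludes infinite paths. Edges to
  \<open>Tick\<close> are dropped, as no path continues there.\<close>

definition succ_rel :: "('v, 'a) graph \<Rightarrow> ('v \<times> 'v) set" where
  "succ_rel G = {(y, x). \<exists>a. (x, a, Vert y) \<in> G}"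

text \<open>
  Being inductive, \<open>returns G v y\<close> says that every maximal path from \<open>y\<close> reaches \<open>v\<close> or
  a deadlock; infinite paths avoiding \<open>v\<close> and termination before \<open>v\<close> are both excluded.
\<close>

inductive returns :: "('v, 'a) graph \<Rightarrow> 'v \<Rightarrow> 'v node \<Rightarrow> bool" for G v where
  here: "returns G v (Vert v)"
| later: "(\<And>a y. (x, a, y) \<in> G \<Longrightarrow> returns G v y) \<Longrightarrow> returns G v (Vert x)"

inductive LEE :: "('v, 'a) graph \<Rightarrow> bool" where
  acyclic: "wf (succ_rel G) \<Longrightarrow> LEE G"
| elim: "returns G v y \<Longrightarrow> LEE (G - {(v, a, y)}) \<Longrightarrow> LEE G"

text \<open>A graph carries no vertex set, so every element of the type is a vertex. The last clause
  keeps edges of \<open>H\<close> away from elements outside the image of \<open>h\<close>, about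
  which \<open>G\<close> says nothing.\<close>

definition functional_bisim :: "('v \<Rightarrow> 'w) \<Rightarrow> ('v, 'a) graph \<Rightarrow> ('w, 'a) graph \<Rightarrow> bool" where
  "functional_bisim h G H \<longleftrightarrow>
     (\<forall>x a y. (x, a, y) \<in> G \<longrightarrow> (h x, a, map_node h y) \<in> H) \<and>
     (\<forall>x a z. (h x, a, z) \<in> H \<longrightarrow> (\<exists>y. (x, a, y) \<in> G \<and> map_node h y = z)) \<and>
     (\<forall>w a z. (w, a, z) \<in> H \<longrightarrow> w \<in> range h)"

lemma returns_mono: "returns G v y \<Longrightarrow> G' \<subseteq> G \<Longrightarrow> returns G' v y"
proof (induction rule: returns.induct)
  case (later x)
  then show ?case by (intro returns.later) blast
qed (rule returns.here)

text \<open>Path lifting: an edge of \<open>H\<close> out of \<open>h x\<close> is the image of an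
  edge of \<open>G\<close> out of \<open>x\<close>, so induction along \<open>G\<close> covers all
  paths of \<open>H\<close>.\<close>

lemma returns_image:
  assumes "functional_bisim h G H" "returns G v y"
  shows "returns H (h v) (map_node h y)"
  using assms(2)
proof (induction rule: returns.induct)
  case here
  then show ?case by (simp add: returns.here)
next
  case (later x)
  have "returns H (h v) z" if "(h x, a, z) \<in> H" for a z
    using later.IH that assms(1) unfolding functional_bisim_def by metis
  then show ?case by (auto intro: returns.later)
qed

text \<open>Infinite paths lift in the same way; vertices outside the image have no outgoing
  edges.\<close>

lemma wf_image:
  assumes "functional_bisim h G H" "wf (succ_rel G)"
  shows "wf (succ_rel H)"
  unfolding wf_def
proof (intro allI impI)
  fix P w
  assume P: "\<forall>x. (\<forall>y. (y, x) \<in> succ_rel H \<longrightarrow> P y) \<longrightarrow> P x"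
  have image: "P (h x)" for x
    using assms(2)
  proof (induction x rule: wf_induct_rule)
    case (less x)
    have "P z" if edge: "(h x, a, Vert z) \<in> H" for a z
    proof -
      obtain y where y: "(x, a, y) \<in> G" "map_node h y = Vert z"
        using edge assms(1) unfolding functional_bisim_def by metis
      then obtain y' where "y = Vert y'" "z = h y'" by (cases y) auto
      then show ?thesis using less y by (auto simp: succ_rel_def)
    qed
    then have "\<forall>y. (y, h x) \<in> succ_rel H \<longrightarrow> P y" by (auto simp: succ_rel_def)
    then show ?case using P by blast
  qed
  show "P w"
  proof (cases "w \<in> range h")
    case True
    then show ?thesis using image by auto
  next
    case False
    then have "(y, w) \<notin> succ_rel H" for y
      using assms(1) unfolding functional_bisim_def succ_rel_def by blast
    then show ?thesis using P by blast
  qed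
qed

text \<open>
  Removing an edge from the image means removing all edges lying above it. This may destroy
  parts of other loops of \<open>G\<close>, which is harmless because \<open>returns\<close> survives the passage to
  subgraphs; hence the induction carries an arbitrary subgraph \<open>G'\<close>.
\<close>

lemma LEE_image:
  assumes "LEE G" "G' \<subseteq> G" "functional_bisim h G' H"
  shows "LEE H"
  using assms
proof (induction arbitrary: G' H rule: LEE.induct)
  case (acyclic G)
  have "wf (succ_rel G')"
    using acyclic by (auto intro: wf_subset simp: succ_rel_def)
  then show ?case using acyclic.prems(2) wf_image LEE.acyclic by blast
next
  case (elim G v y a)
  show ?case
  proof (cases "(v, a, y) \<in> G'")
    case False
    then show ?thesis using elim.IH[of G' H] elim.prems by blast
  next
    case True
    let ?e = "(h v, a, map_node h y)"
    let ?G'' = "G' - {(x, b, z). (h x, b, map_node h z) = ?e}"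
    have "functional_bisim h ?G'' (H - {?e})"
      unfolding functional_bisim_def
    proof (intro conjI allI impI)
      fix x b z assume "(h x, b, z) \<in> H - {?e}"
      moreover from this obtain y' where "(x, b, y') \<in> G'" "map_node h y' = z"
        using elim.prems(2) unfolding functional_bisim_def by (meson DiffD1)
      ultimately show "\<exists>y. (x, b, y) \<in> ?G'' \<and> map_node h y = z" by auto
    next
      fix w b z assume "(w, b, z) \<in> H - {?e}"
      then show "w \<in> range h"
        using elim.prems(2) unfolding functional_bisim_def by (meson DiffD1)
    qed (use elim.prems(2) in \<open>auto simp: functional_bisim_def\<close>)
    moreover have "?G'' \<subseteq> G - {(v, a, y)}" using elim.prems(1) by auto
    ultimately have "LEE (H - {?e})" using elim.IH by blast
    moreover have "returns H (h v) (map_node h y)"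
      by (rule returns_image[OF elim.prems(2) returns_mono[OF elim.hyps(1) elim.prems(1)]])
    ultimately show ?thesis by (rule LEE.elim[rotated])
  qed
qed

text \<open>\<open>returns\<close> persists in subgraphs, so the edges of \<open>L\<close> can be
  removed one after the other in any order.\<close>

lemma LEE_elim_many:
  assumes "finite L" "\<And>v a y. (v, a, y) \<in> L \<Longrightarrow> returns G v y" "LEE (G - L)"
  shows "LEE G"
  using assms
proof (induction L)
  case (insert e L)
  obtain v a y where e: "e = (v, a, y)" by (cases e)
  have "returns (G - L) v y"
    using insert.prems(1) e returns_mono by fastforce
  moreover have "LEE (G - L - {(v, a, y)})"
    using insert.prems(2) unfolding e by (subst (asm) Diff_insert)
  ultimately have "LEE (G - L)" by (rule LEE.elim)
  then show ?case by (rule insert.IH[rotated]) (rule insert.prems(1)[OF insertI2])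
qed simp

section \<open>Unique solvability\<close>

fun summand :: "('v \<Rightarrow> 'a stexp) \<Rightarrow> 'a \<Rightarrow> 'v node \<Rightarrow> 'a stexp" where
  "summand s a Tick = Act a"
| "summand s a (Vert y) = Act a \<odot> s y"

definition summands :: "('v \<Rightarrow> 'a stexp) \<Rightarrow> ('v, 'a) graph \<Rightarrow> 'v \<Rightarrow> 'a stexp set" where
  "summands s G x = {summand s a y | a y. (x, a, y) \<in> G}"

text \<open>
  \<open>R x\<close> accumulates the loops at \<open>x\<close> that have already been eliminated from \<open>G\<close>;
  \<open>R x = Zero\<close> gives the plain equation of the chart.
\<close>

definition solves ::
  "'a set \<Rightarrow> ('v \<Rightarrow> 'a stexp) \<Rightarrow> ('v, 'a) graph \<Rightarrow> ('v \<Rightarrow> 'a stexp) \<Rightarrow> 'v \<Rightarrow> bool" where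
  "solves A R G s x \<longleftrightarrow> BBP A (s x) (R x \<star> ssum (summands s G x))"

definition graph_over :: "'a set \<Rightarrow> ('v, 'a) graph \<Rightarrow> bool" where
  "graph_over A G \<longleftrightarrow> finite G \<and> (\<forall>x a y. (x, a, y) \<in> G \<longrightarrow> a \<in> A)"

lemma finite_edges_image:
  assumes "finite G"
  shows "finite {f a y | a y. (x, a, y) \<in> G}"
proof -
  have "{f a y | a y. (x, a, y) \<in> G} \<subseteq> (\<lambda>(x, a, y). f a y) ` G" by force
  then show ?thesis using assms finite_surj by blast
qed

lemma finite_summands: "graph_over A G \<Longrightarrow> finite (summands s G x)"
  by (simp add: graph_over_def summands_def finite_edges_image)

lemma solves_StExp: "solves A R G s x \<Longrightarrow> s x \<in> StExp A"
  unfolding solves_def using BBP_StExp by blast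

lemma summand_StExp:
  "a \<in> A \<Longrightarrow> (\<And>z. y = Vert z \<Longrightarrow> s z \<in> StExp A) \<Longrightarrow> summand s a y \<in> StExp A"
  by (cases y) auto

lemma summands_StExp:
  "graph_over A G \<Longrightarrow> (\<And>x. s x \<in> StExp A) \<Longrightarrow> summands s G x \<subseteq> StExp A"
  by (auto simp: summands_def graph_over_def intro!: summand_StExp)

text \<open>The factor \<open>r\<close> describes the behaviour from taking the edge until the
  return to \<open>v\<close>. It must not depend on \<open>s\<close>, since it becomes part of the
  system. At each \<open>x\<close> on the way, (B4) extracts \<open>s v\<close> from the sum over
  the successors, (BKS2) from the loop at \<open>x\<close>, and (B5) from behind the action.\<close>

lemma returns_factor:
  assumes "returns G v y" "graph_over A G" "\<And>x. R x \<in> StExp A" "a \<in> A"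
  shows "\<exists>r \<in> StExp A. \<forall>s. s v \<in> StExp A \<longrightarrow> (\<forall>x. x \<noteq> v \<longrightarrow> solves A R G s x) \<longrightarrow>
           BBP A (summand s a y) (r \<odot> s v)"
  using assms(1,4)
proof (induction arbitrary: a rule: returns.induct)
  case here
  then show ?case by (intro bexI[of _ "Act a"]) (auto intro: BBP.Refl)
next
  case (later x)
  show ?case
  proof (cases "x = v")
    \<comment> \<open>A path that comes back to \<open>v\<close> stops there, as no equation is
      assumed at \<open>v\<close>.\<close>
    case True
    then show ?thesis using later.prems by (intro bexI[of _ "Act a"]) (auto intro: BBP.Refl)
  next
    case False
    have "\<forall>b y. \<exists>r. (x, b, y) \<in> G \<longrightarrow> r \<in> StExp A \<and>
        (\<forall>s. s v \<in> StExp A \<longrightarrow> (\<forall>x. x \<noteq> v \<longrightarrow> solves A R G s x) \<longrightarrow>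
           BBP A (summand s b y) (r \<odot> s v))"
      using later.IH assms(2) unfolding graph_over_def by meson
    then obtain r where r: "\<And>b y. (x, b, y) \<in> G \<Longrightarrow> r b y \<in> StExp A"
      and eq: "\<And>b y s. (x, b, y) \<in> G \<Longrightarrow> s v \<in> StExp A \<Longrightarrow> (\<forall>x. x \<noteq> v \<longrightarrow> solves A R G s x) \<Longrightarrow>
         BBP A (summand s b y) (r b y \<odot> s v)"
      by metis
    define S where "S = {r b y | b y. (x, b, y) \<in> G}"
    have S: "finite S" "S \<subseteq> StExp A"
      using assms(2) r by (auto simp: S_def graph_over_def finite_edges_image)
    let ?r = "R x \<star> ssum S"
    have rS: "?r \<in> StExp A" using S assms(3) by (simp add: ssum_StExp)
    have "BBP A (summand s a (Vert x)) ((Act a \<odot> ?r) \<odot> s v)"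
      if s: "s v \<in> StExp A" "\<forall>x. x \<noteq> v \<longrightarrow> solves A R G s x" for s
    proof -
      have "BBP A (s x) (R x \<star> ssum (summands s G x))"
        using s False by (simp add: solves_def)
      also have "BBP A \<dots> (R x \<star> ssum ((\<lambda>r. r \<odot> s v) ` S))"
      proof (intro BBP.Cong_Star BBP.Refl assms(3) ssum_cong)
        show "finite (summands s G x)" "finite ((\<lambda>r. r \<odot> s v) ` S)"
          using assms(2) S finite_summands by auto
      next
        fix t assume "t \<in> summands s G x"
        then show "\<exists>u \<in> (\<lambda>r. r \<odot> s v) ` S. BBP A t u"
          using eq[OF _ s] unfolding summands_def S_def by blast
      next
        fix u assume "u \<in> (\<lambda>r. r \<odot> s v) ` S"
        then show "\<exists>t \<in> summands s G x. BBP A t u"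
          using eq[OF _ s] unfolding summands_def S_def by blast
      qed
      also have "BBP A \<dots> (R x \<star> (ssum S \<odot> s v))"
        using S s assms(3) by (intro BBP.Cong_Star BBP.Refl BBP.Sym[OF ssum_Seq]) auto
      also have "BBP A \<dots> (?r \<odot> s v)"
        using S s assms(3) by (intro BBP.Sym[OF BBP.Axiom] BKS2) (auto simp: ssum_StExp)
      finally have "BBP A (summand s a (Vert x)) (Act a \<odot> (?r \<odot> s v))"
        using later.prems by (auto intro!: BBP.Cong_Seq BBP.Refl)
      also have "BBP A \<dots> ((Act a \<odot> ?r) \<odot> s v)"
        using later.prems rS s by (intro BBP.Sym[OF BBP.Axiom] B5) auto
      finally show ?thesis .
    qed
    then show ?thesis using rS later.prems by (intro bexI[of _ "Act a \<odot> ?r"]) auto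
  qed
qed

text \<open>The summand of the removed edge is split off and rewritten to
  \<open>r \<odot> s v\<close>; \<open>BBP_Star_shift\<close> then moves it into the loop.\<close>

lemma solves_eliminated_edge:
  assumes "graph_over A G" "\<And>x. R x \<in> StExp A" "r \<in> StExp A" "(v, a, y) \<in> G"
    and StExp: "\<And>x. s x \<in> StExp A"
    and summand: "BBP A (summand s a y) (r \<odot> s v)"
  shows "solves A R G s v \<longleftrightarrow> solves A (R(v := R v \<oplus> r)) (G - {(v, a, y)}) s v"
proof -
  let ?T = "summands s (G - {(v, a, y)}) v"
  have G': "graph_over A (G - {(v, a, y)})" using assms(1) by (auto simp: graph_over_def)
  have T: "finite ?T" "?T \<subseteq> StExp A"
    by (rule finite_summands[OF G'], rule summands_StExp[OF G' StExp])
  have "BBP A (ssum (insert (summand s a y) ?T)) (summand s a y \<oplus> ssum ?T)"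
    using T BBP_StExp[OF summand] by (intro ssum_insert) auto
  also have "BBP A \<dots> ((r \<odot> s v) \<oplus> ssum ?T)"
    using T summand by (intro BBP.Cong_Plus BBP.Refl) (auto simp: ssum_StExp)
  \<comment> \<open>Another edge may give the same summand, which then lies in \<open>?T\<close>
    already; sums over sets absorb this.\<close>
  also have "insert (summand s a y) ?T = summands s G v"
    using assms(4) by (auto simp: summands_def)
  finally have "BBP A (R v \<star> ssum (summands s G v)) (R v \<star> ((r \<odot> s v) \<oplus> ssum ?T))"
    using assms(2) by (intro BBP.Cong_Star BBP.Refl)
  then show ?thesis
    using assms T by (simp add: solves_def BBP_cong_right BBP_Star_shift ssum_StExp)
qed

text \<open>Generalised over \<open>R\<close>, as each elimination enlarges \<open>R\<close> at one
  vertex. Without infinite paths the equations define their solution by recursion on successors; an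
  elimination step preserves the set of solutions.\<close>

lemma LEE_unique_solution:
  assumes "LEE G" "graph_over A G" "\<And>x. R x \<in> StExp A"
  shows "\<exists>s. (\<forall>x. solves A R G s x) \<and>
           (\<forall>s'. (\<forall>x. solves A R G s' x) \<longrightarrow> (\<forall>x. BBP A (s' x) (s x)))"
  using assms
proof (induction arbitrary: R rule: LEE.induct)
  case (acyclic G)
  define s where "s = wfrec (succ_rel G) (\<lambda>s x. R x \<star> ssum (summands s G x))"
  \<comment> \<open>The equation at \<open>x\<close> reads \<open>s\<close> only at successors of
    \<open>x\<close>, so the cut made by well-founded recursion has no effect.\<close>
  have "summands (cut s (succ_rel G) x) G x = summands s G x" for x
  proof -
    have "summand (cut s (succ_rel G) x) a y = summand s a y" if "(x, a, y) \<in> G" for a y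
      using that by (cases y) (auto intro!: cut_apply simp: succ_rel_def)
    then show ?thesis unfolding summands_def by metis
  qed
  then have s: "s x = R x \<star> ssum (summands s G x)" for x
    using wfrec[OF acyclic.hyps, of "\<lambda>s x. R x \<star> ssum (summands s G x)" x]
    by (simp add: s_def)
  have StExp: "s x \<in> StExp A" for x
    using acyclic.hyps
  proof (induction x rule: wf_induct_rule)
    case (less x)
    have "summands s G x \<subseteq> StExp A"
      using less acyclic.prems(1)
      by (force simp: summands_def graph_over_def succ_rel_def intro!: summand_StExp)
    then have "R x \<star> ssum (summands s G x) \<in> StExp A"
      using acyclic.prems by (simp add: ssum_StExp finite_summands)
    then show ?case using s by metis
  qed
  have "solves A R G s x" for x
    unfolding solves_def using s StExp BBP.Refl by metis
  moreover have "BBP A (s' x) (s x)" if s': "\<And>x. solves A R G s' x" for s' x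
    using acyclic.hyps
  proof (induction x rule: wf_induct_rule)
    case (less x)
    have eq: "BBP A (summand s' a y) (summand s a y)" if "(x, a, y) \<in> G" for a y
      using that less acyclic.prems(1)
      by (cases y) (force simp: graph_over_def succ_rel_def intro!: BBP.Cong_Seq BBP.Refl)+
    have "BBP A (s' x) (R x \<star> ssum (summands s' G x))"
      using s' by (simp add: solves_def)
    also have "BBP A \<dots> (R x \<star> ssum (summands s G x))"
      using acyclic.prems eq
      by (intro BBP.Cong_Star BBP.Refl ssum_cong finite_summands) (auto simp: summands_def)
    finally show ?case by (simp flip: s)
  qed
  ultimately show ?case by blast
next
  case (elim G v y a)
  show ?case
  proof (cases "(v, a, y) \<in> G")
    case False
    then show ?thesis using elim by simp
  next
    case True
    let ?G = "G - {(v, a, y)}"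
    have "a \<in> A" using True elim.prems by (auto simp: graph_over_def)
    then obtain r where r: "r \<in> StExp A"
      and eq: "\<And>s. s v \<in> StExp A \<Longrightarrow> \<forall>x. x \<noteq> v \<longrightarrow> solves A R G s x \<Longrightarrow>
                 BBP A (summand s a y) (r \<odot> s v)"
      using returns_factor[where R = R, OF elim.hyps(1) elim.prems] by blast
    let ?R = "R(v := R v \<oplus> r)"
    have other: "solves A R G s x \<longleftrightarrow> solves A ?R ?G s x" if "x \<noteq> v" for s x
      using that by (simp add: solves_def summands_def)
    have equiv: "(\<forall>x. solves A R G s x) \<longleftrightarrow> (\<forall>x. solves A ?R ?G s x)" for s
    \<comment> \<open>\<open>eq\<close> presupposes the equations away from \<open>v\<close>, which
      both systems share. If these fail, or if \<open>s\<close> leaves \<open>StExp A\<close>,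
      neither system is solved.\<close>
    proof (cases "(\<forall>x. s x \<in> StExp A) \<and> (\<forall>x. x \<noteq> v \<longrightarrow> solves A R G s x)")
      case True
      then have "solves A R G s v \<longleftrightarrow> solves A ?R ?G s v"
        using eq r elim.prems \<open>(v, a, y) \<in> G\<close> by (intro solves_eliminated_edge) auto
      then show ?thesis using other by metis
    next
      case False
      then show ?thesis using other solves_StExp by metis
    qed
    have "graph_over A ?G" using elim.prems(1) by (auto simp: graph_over_def)
    moreover have "?R x \<in> StExp A" for x using elim.prems(2) r by simp
    ultimately show ?thesis unfolding equiv by (rule elim.IH)
  qed
qed

section \<open>Charts of star expressions\<close>

text \<open>
  The edges by which a loop is entered, graded by the size of the loop body, so that loops nested
  in a body come first in the elimination order. A step is an entry only if the star whose loop
  it starts is the head of the source; the steps of a sum are never entries.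
\<close>

inductive entry :: "nat \<Rightarrow> 'a stexp \<Rightarrow> 'a \<Rightarrow> 'a stexp node \<Rightarrow> bool" where
  entry_Star: "step e1 a (Vert f) \<Longrightarrow> entry (size e1) (e1 \<star> e2) a (Vert (f \<odot> (e1 \<star> e2)))"
| entry_Star_Tick: "step e1 a Tick \<Longrightarrow> entry (size e1) (e1 \<star> e2) a (Vert (e1 \<star> e2))"
| entry_Seq: "entry n e a (Vert f) \<Longrightarrow> entry n (e \<odot> g) a (Vert (f \<odot> g))"

text \<open>Stage \<open>n\<close> of the elimination: entries into loops with bodies of size below
  \<open>n\<close> are gone, and stage 0 has all steps.\<close>

definition pruned :: "nat \<Rightarrow> ('a stexp, 'a) graph" where
  "pruned n = {(x, a, y). step x a y \<and> (\<forall>m<n. \<not> entry m x a y)}"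

text \<open>By \<open>entry_Seq\<close>, an entry of \<open>f\<close> remains one in the product, so
  surviving steps of the product come from surviving steps of \<open>f\<close>. Steps to
  \<open>Tick\<close> are never entries.\<close>

lemma pruned_SeqE:
  assumes "(f \<odot> g, a, z) \<in> pruned n"
  obtains f' where "(f, a, Vert f') \<in> pruned n" "z = Vert (f' \<odot> g)"
  | "(f, a, Tick) \<in> pruned n" "z = Vert g"
proof -
  have st: "step (f \<odot> g) a z" and ne: "\<And>m. m < n \<Longrightarrow> \<not> entry m (f \<odot> g) a z"
    using assms by (auto simp: pruned_def)
  from st consider f' where "step f a (Vert f')" "z = Vert (f' \<odot> g)" | "step f a Tick" "z = Vert g"
    by (auto elim: step_SeqE)
  then show thesis
  proof cases
    case 1
    then have "(f, a, Vert f') \<in> pruned n" using ne by (auto simp: pruned_def intro: entry_Seq)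
    then show ?thesis using 1 that(1) by blast
  next
    case 2
    then have "(f, a, Tick) \<in> pruned n" by (auto simp: pruned_def elim: entry.cases)
    then show ?thesis using 2 that(2) by blast
  qed
qed

text \<open>Accessibility replaces well-foundedness because \<open>pruned n\<close> still contains
  the loops of larger expressions. A path from the product first runs through \<open>f\<close>, then
  possibly through \<open>g\<close>.\<close>

lemma acc_Seq:
  assumes "f \<in> Wellfounded.acc (succ_rel (pruned n))" "g \<in> Wellfounded.acc (succ_rel (pruned n))"
  shows "f \<odot> g \<in> Wellfounded.acc (succ_rel (pruned n))"
  using assms(1)
proof (induction rule: acc_induct_rule)
  case (1 f)
  show ?case
  proof (rule accI)
    fix y assume "(y, f \<odot> g) \<in> succ_rel (pruned n)"
    then show "y \<in> Wellfounded.acc (succ_rel (pruned n))"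
      using 1 assms(2) by (auto simp: succ_rel_def elim!: pruned_SeqE)
  qed
qed

text \<open>A star inside \<open>e\<close> has a body smaller than \<open>n\<close>, so its entries
  are removed and only the exits into its second argument remain. A sum keeps its steps, but they
  lead into the charts of its arguments.\<close>

lemma reach_acc:
  assumes "size e \<le> n"
  shows "reach e \<subseteq> insert Tick (Vert ` Wellfounded.acc (succ_rel (pruned n)))"
  using assms
proof (induction e)
  case Zero
  have "Zero \<in> Wellfounded.acc (succ_rel (pruned n))"
    by (rule accI) (auto simp: succ_rel_def pruned_def elim: step_ZeroE)
  moreover have "reach Zero \<subseteq> {Vert Zero}"
    by (rule reach_subset) (auto elim: step_ZeroE)
  ultimately show ?case by auto
next
  case (Act b)
  have "Act b \<in> Wellfounded.acc (succ_rel (pruned n))"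
    by (rule accI) (auto simp: succ_rel_def pruned_def elim: step_ActE)
  moreover have "reach (Act b) \<subseteq> {Vert (Act b), Tick}"
    by (rule reach_subset) (auto elim: step_ActE)
  ultimately show ?case by auto
next
  case (Plus e1 e2)
  let ?W = "insert Tick (Vert ` Wellfounded.acc (succ_rel (pruned n)))"
  have IH: "reach e1 \<subseteq> ?W" "reach e2 \<subseteq> ?W" using Plus by auto
  have sub: "\<xi> \<in> reach e1 \<union> reach e2" if "step (e1 \<oplus> e2) a \<xi>" for a \<xi>
    using that by (auto elim!: step_PlusE intro: reach_step[OF reach_refl])
  have "e1 \<oplus> e2 \<in> Wellfounded.acc (succ_rel (pruned n))"
    by (rule accI) (use sub IH in \<open>fastforce simp: succ_rel_def pruned_def\<close>)
  moreover have "reach (e1 \<oplus> e2) \<subseteq> insert (Vert (e1 \<oplus> e2)) (reach e1 \<union> reach e2)"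
    by (rule reach_subset) (use sub in \<open>auto intro: reach_step\<close>)
  ultimately show ?case using IH by blast
next
  case (Seq e1 e2)
  let ?W = "insert Tick (Vert ` Wellfounded.acc (succ_rel (pruned n)))"
  have IH: "reach e1 \<subseteq> ?W" "reach e2 \<subseteq> ?W" using Seq by auto
  have "reach (e1 \<odot> e2) \<subseteq> {Vert (f \<odot> e2) | f. Vert f \<in> reach e1} \<union> reach e2"
    by (rule reach_subset) (auto elim!: step_SeqE intro: reach_refl reach_step reach_step[OF reach_refl])
  also have "\<dots> \<subseteq> ?W"
    using IH reach_refl[of e2] by (auto intro!: imageI acc_Seq)
  finally show ?case .
next
  case (Star e1 e2)
  let ?W = "insert Tick (Vert ` Wellfounded.acc (succ_rel (pruned n)))"
  have IH: "reach e1 \<subseteq> ?W" "reach e2 \<subseteq> ?W" using Star by auto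
  have "y \<in> Wellfounded.acc (succ_rel (pruned n))" if "(e1 \<star> e2, a, Vert y) \<in> pruned n" for a y
  proof -
    have "size e1 < n" using Star.prems by simp
    then have "step e2 a (Vert y)"
      using that by (auto simp: pruned_def elim!: step_StarE intro: entry_Star entry_Star_Tick)
    then show ?thesis using IH(2) reach_step[OF reach_refl] by fastforce
  qed
  then have "y \<in> Wellfounded.acc (succ_rel (pruned n))" if "(y, e1 \<star> e2) \<in> succ_rel (pruned n)" for y
    using that unfolding succ_rel_def by blast
  then have star: "e1 \<star> e2 \<in> Wellfounded.acc (succ_rel (pruned n))"
    by (rule accI)
  have "reach (e1 \<star> e2) \<subseteq>
    insert (Vert (e1 \<star> e2)) ({Vert (f \<odot> (e1 \<star> e2)) | f. Vert f \<in> reach e1} \<union> reach e2)"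
    by (rule reach_subset)
      (auto elim!: step_StarE step_SeqE intro: reach_refl reach_step reach_step[OF reach_refl])
  also have "\<dots> \<subseteq> ?W" using IH star by (auto intro!: imageI acc_Seq)
  finally show ?case .
qed

text \<open>Every path through the accessible body ends, in a deadlock or by termination, and
  termination leads back to the star.\<close>

lemma returns_Star_body:
  assumes "f \<in> Wellfounded.acc (succ_rel (pruned n))"
  shows "returns (pruned n) (e1 \<star> e2) (Vert (f \<odot> (e1 \<star> e2)))"
  using assms
proof (induction rule: acc_induct_rule)
  case (1 f)
  show ?case
    by (rule returns.later) (use 1 in \<open>auto simp: succ_rel_def elim!: pruned_SeqE intro: returns.here\<close>)
qed

text \<open>A path that has to reach \<open>x\<close> or a deadlock before terminating never
  releases the context \<open>g\<close>.\<close>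

lemma returns_Seq:
  assumes "returns (pruned n) x y"
  shows "y = Vert f \<Longrightarrow> returns (pruned n) (x \<odot> g) (Vert (f \<odot> g))"
  using assms
proof (induction arbitrary: f rule: returns.induct)
  case here
  then show ?case by (auto intro: returns.here)
next
  case (later z)
  have "\<not> returns (pruned n) x Tick" by (auto elim: returns.cases)
  then show ?case
    using later by (intro returns.later) (auto elim!: pruned_SeqE)
qed

text \<open>At the stage given by the size of the body, all loops inside the body are gone, so
  \<open>reach_acc\<close> makes \<open>f\<close> accessible.\<close>

lemma entry_returns: "entry n x a y \<Longrightarrow> returns (pruned n) x y"
proof (induction rule: entry.induct)
  case (entry_Star e1 a f e2)
  then have "f \<in> Wellfounded.acc (succ_rel (pruned (size e1)))"
    using reach_acc[OF order_refl, of e1] reach_step[OF reach_refl] by fastforce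
  then show ?case by (rule returns_Star_body)
qed (auto intro: returns.here returns_Seq)

definition step_graph :: "'a stexp set \<Rightarrow> ('a stexp, 'a) graph" where
  "step_graph V = {(x, a, y). x \<in> V \<and> step x a y}"

lemma finite_step_graph:
  assumes "finite V"
  shows "finite (step_graph V)"
proof -
  have "step_graph V = (\<Union>x\<in>V. (\<lambda>(a, y). (x, a, y)) ` {(a, y). step x a y})"
    by (auto simp: step_graph_def)
  then show ?thesis using assms by (simp only: finite_UN_I finite_imageI finite_steps)
qed

lemma LEE_step_graph:
  assumes "finite V"
  shows "LEE (step_graph V)"
proof -
  \<comment> \<open>Since \<open>N\<close> bounds all vertices of \<open>V\<close>, no infinite path
    is left at stage \<open>N\<close>.\<close>
  define N where "N = Max (size ` V)"
  have N: "size x \<le> N" if "x \<in> V" for x using that assms by (simp add: N_def)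
  let ?G = "\<lambda>n. pruned n \<inter> step_graph V"
  have "x \<in> Wellfounded.acc (succ_rel (?G N))" for x
  proof (cases "x \<in> V")
    case True
    have "x \<in> Wellfounded.acc (succ_rel (pruned N))"
      using reach_acc[OF N[OF True]] reach_refl[of x] by auto
    moreover have "succ_rel (?G N) \<subseteq> succ_rel (pruned N)" by (auto simp: succ_rel_def)
    ultimately show ?thesis using acc_subset by blast
  next
    case False
    then have "(y, x) \<notin> succ_rel (?G N)" for y by (simp add: succ_rel_def step_graph_def)
    then show ?thesis by (blast intro: accI)
  qed
  then have base: "LEE (?G N)" by (intro LEE.acyclic) (simp add: wf_iff_acc)
  \<comment> \<open>Backwards through the stages: stage \<open>n\<close> is stage
    \<open>Suc n\<close> with the entries \<open>?L\<close> of level \<open>n\<close> put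
    back.\<close>
  have "LEE (?G 0)"
    using le0[of N]
  proof (induction rule: inc_induct)
    case base
    show ?case by (rule \<open>LEE (?G N)\<close>)
  next
    case (step n)
    let ?L = "{(x, a, y). entry n x a y} \<inter> step_graph V"
    have "?G n - ?L = ?G (Suc n)"
      by (auto simp: pruned_def less_Suc_eq)
    moreover have "finite ?L" using finite_step_graph[OF assms] by simp
    moreover have "returns (?G n) x y" if "(x, a, y) \<in> ?L" for x a y
      using that by (auto intro: returns_mono[OF entry_returns])
    ultimately show ?case using LEE_elim_many[of ?L "?G n"] step.IH by simp
  qed
  moreover have "?G 0 = step_graph V" by (auto simp: pruned_def step_graph_def)
  ultimately show ?thesis by simp
qed

section \<open>Every expression solves the equations of its own chart\<close>

lemma summand_Collect:
  "{summand s a y | a y. P a y} = {Act a \<odot> s f | a f. P a (Vert f)} \<union> {Act a | a. P a Tick}"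
  (is "?L = ?R")
proof
  show "?L \<subseteq> ?R"
  proof
    fix x assume "x \<in> ?L"
    then obtain a y where "x = summand s a y" "P a y" by blast
    then show "x \<in> ?R" by (cases y) auto
  qed
  have "Act a \<odot> s f \<in> ?L" if "P a (Vert f)" for a f
    using that summand.simps(2)[of s a f] by (metis (mono_tags, lifting) mem_Collect_eq)
  moreover have "Act a \<in> ?L" if "P a Tick" for a
    using that summand.simps(1)[of s a] by (metis (mono_tags, lifting) mem_Collect_eq)
  ultimately show "?R \<subseteq> ?L" by blast
qed

lemma step_Seq_iff:
  "step (e \<odot> g) a y \<longleftrightarrow> (\<exists>f. y = Vert (f \<odot> g) \<and> step e a (Vert f)) \<or> (y = Vert g \<and> step e a Tick)"
  by (auto elim: step_SeqE intro: step_Seq step_Seq_Tick)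

text \<open>The operational counterpart of (BKS1).\<close>

lemma step_Star_iff:
  "step (e \<star> g) a y \<longleftrightarrow> step (e \<odot> (e \<star> g)) a y \<or> step g a y"
  by (auto simp: step_Seq_iff elim: step_StarE intro: step.intros)

text \<open>(B4) distributes \<open>g\<close> over the expansion of \<open>e\<close>, and (B5)
  reassociates. Shared by products and stars; for a star, \<open>g\<close> is the star
  itself.\<close>

lemma summands_step_Seq:
  assumes "e \<in> StExp A" "g \<in> StExp A" "BBP A e (ssum {summand (\<lambda>x. x) a y | a y. step e a y})"
  shows "BBP A (e \<odot> g) (ssum ({Act a \<odot> (f \<odot> g) | a f. step e a (Vert f)} \<union>
           {Act a \<odot> g | a. step e a Tick}))" (is "BBP A _ (ssum ?T)")
proof -
  let ?S = "{summand (\<lambda>x. x) a y | a y. step e a y}"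
  have fin: "finite ?S"
  proof -
    have "?S = (\<lambda>(a, y). summand (\<lambda>x. x) a y) ` {(a, y). step e a y}" by auto
    then show ?thesis by (simp add: finite_steps)
  qed
  have St: "a \<in> A" "y = Vert f \<Longrightarrow> f \<in> StExp A" if "step e a y" for a y f
    using step_StExp[OF that assms(1)] by auto
  have S: "?S \<subseteq> StExp A" using St by (fastforce intro!: summand_StExp)
  have "finite ?T"
  proof -
    have "?T = (\<lambda>(a, y). case y of Tick \<Rightarrow> Act a \<odot> g | Vert f \<Rightarrow> Act a \<odot> (f \<odot> g)) ` {(a, y). step e a y}"
      by (force split: node.splits)
    then show ?thesis by (simp only: finite_imageI finite_steps)
  qed
  have "BBP A (e \<odot> g) (ssum ?S \<odot> g)" using assms by (intro BBP.Cong_Seq BBP.Refl)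
  also have "BBP A \<dots> (ssum ((\<lambda>x. x \<odot> g) ` ?S))" by (rule ssum_Seq[OF fin S assms(2)])
  also have "BBP A \<dots> (ssum ?T)"
  proof (rule ssum_cong)
    fix x assume "x \<in> (\<lambda>x. x \<odot> g) ` ?S"
    then obtain a y where "step e a y" "x = summand (\<lambda>x. x) a y \<odot> g" by auto
    then show "\<exists>t \<in> ?T. BBP A x t"
      using St assms(2) by (cases y) (fastforce intro: BBP.Refl BBP.Axiom[OF B5])+
  next
    fix t assume "t \<in> ?T"
    then consider a f where "step e a (Vert f)" "t = Act a \<odot> (f \<odot> g)"
      | a where "step e a Tick" "t = Act a \<odot> g" by auto
    then show "\<exists>x \<in> (\<lambda>x. x \<odot> g) ` ?S. BBP A x t"
    proof cases
      case 1
      then have "BBP A (summand (\<lambda>x. x) a (Vert f) \<odot> g) t"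
        using St assms(2) by (auto intro!: BBP.Axiom B5)
      then show ?thesis using 1 by blast
    next
      case 2
      then have "BBP A (summand (\<lambda>x. x) a Tick \<odot> g) t"
        using St assms(2) by (auto intro!: BBP.Refl)
      then show ?thesis using 2 by blast
    qed
  qed (use fin \<open>finite ?T\<close> in auto)
  finally show ?thesis .
qed

lemma BBP_fundamental:
  assumes "e \<in> StExp A"
  shows "BBP A e (ssum {summand (\<lambda>x. x) a y | a y. step e a y})"
  using assms
proof (induction e rule: stexp.induct)
  case Zero
  have "{summand (\<lambda>x. x) a y | a y. step Zero a y} = ({} :: 'a stexp set)" by (auto elim: step_ZeroE)
  then show ?case using BBP.Sym[OF ssum_empty] by metis
next
  case (Act b)
  have "{summand (\<lambda>x. x) a y | a y. step (Act b) a y} = set [Act b]"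
    by (force elim: step_ActE intro: step_Act)
  moreover have "BBP A (Act b) (ssum (set [Act b]))"
  proof (rule BBP.Sym)
    have "BBP A (ssum (set [Act b])) (Act b \<oplus> Zero)"
      using ssum_set[of "[Act b]" A] Act by simp
    also have "BBP A \<dots> (Act b)" using Act by (intro BBP.Axiom B6) auto
    finally show "BBP A (ssum (set [Act b])) (Act b)" .
  qed
  ultimately show ?case by (simp only:)
next
  case (Plus e1 e2)
  let ?S = "\<lambda>e. {summand (\<lambda>x. x) a y | a y. step e a y}"
  have fin: "finite (?S e)" for e :: "'a stexp"
  proof -
    have "?S e = (\<lambda>(a, y). summand (\<lambda>x. x) a y) ` {(a, y). step e a y}" by auto
    then show ?thesis by (simp add: finite_steps)
  qed
  have IH: "BBP A e1 (ssum (?S e1))" "BBP A e2 (ssum (?S e2))" using Plus by auto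
  have Un: "?S (e1 \<oplus> e2) = ?S e1 \<union> ?S e2"
    by (auto elim!: step_PlusE intro: step_Plus1 step_Plus2)
  have "BBP A (e1 \<oplus> e2) (ssum (?S e1) \<oplus> ssum (?S e2))" using IH by (rule BBP.Cong_Plus)
  also have "BBP A \<dots> (ssum (?S e1 \<union> ?S e2))"
    using IH[THEN BBP_StExp] ssum_StExp[OF fin[of e1], of A] ssum_StExp[OF fin[of e2], of A]
    by (intro BBP.Sym[OF ssum_Un] fin) blast+
  finally show ?case unfolding Un .
next
  case (Seq e1 e2)
  have "{summand (\<lambda>x. x) a y | a y. step (e1 \<odot> e2) a y} =
    {Act a \<odot> (f \<odot> e2) | a f. step e1 a (Vert f)} \<union> {Act a \<odot> e2 | a. step e1 a Tick}"
    by (auto simp: summand_Collect step_Seq_iff)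
  then show ?case using Seq summands_step_Seq[of e1 A e2] by simp
next
  case (Star e1 e2)
  let ?S = "\<lambda>e. {summand (\<lambda>x. x) a y | a y. step e a y}"
  let ?T = "{Act a \<odot> (f \<odot> (e1 \<star> e2)) | a f. step e1 a (Vert f)} \<union> {Act a \<odot> (e1 \<star> e2) | a. step e1 a Tick}"
  have St: "e1 \<in> StExp A" "e2 \<in> StExp A" using Star.prems by auto
  have T: "BBP A (e1 \<odot> (e1 \<star> e2)) (ssum ?T)"
    using Star by (intro summands_step_Seq) auto
  have IH: "BBP A e2 (ssum (?S e2))" using Star by auto
  have eq: "?S (e1 \<star> e2) = ?T \<union> ?S e2"
    by (auto simp: summand_Collect step_Star_iff step_Seq_iff)
  have "finite (?S (e1 \<star> e2))"
  proof -
    have "?S (e1 \<star> e2) = (\<lambda>(a, y). summand (\<lambda>x. x) a y) ` {(a, y). step (e1 \<star> e2) a y}" by auto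
    then show ?thesis by (simp only: finite_imageI finite_steps)
  qed
  then have fin: "finite ?T" "finite (?S e2)" by (simp_all only: eq finite_Un)
  have "BBP A (e1 \<star> e2) ((e1 \<odot> (e1 \<star> e2)) \<oplus> e2)"
    using St by (intro BBP.Sym[OF BBP.Axiom] BKS1) auto
  also have "BBP A \<dots> (ssum ?T \<oplus> ssum (?S e2))" using T IH by (rule BBP.Cong_Plus)
  also have "BBP A \<dots> (ssum (?T \<union> ?S e2))"
    using BBP_StExp[OF T] BBP_StExp[OF IH] ssum_StExp[OF fin(1), of A] ssum_StExp[OF fin(2), of A]
    by (intro BBP.Sym[OF ssum_Un] fin) blast+
  finally show ?case unfolding eq .
qed

section \<open>Completeness\<close>

text \<open>The largest bisimulation on all expressions at once. As an equivalence, it yields a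
  common quotient of both charts.\<close>

coinductive bisim :: "'a stexp node \<Rightarrow> 'a stexp node \<Rightarrow> bool" where
  bisim_Tick: "bisim Tick Tick"
| bisim_Vert: "(\<forall>a x'. step x a x' \<longrightarrow> (\<exists>y'. step y a y' \<and> bisim x' y')) \<Longrightarrow>
    (\<forall>a y'. step y a y' \<longrightarrow> (\<exists>x'. step x a x' \<and> bisim x' y')) \<Longrightarrow>
    bisim (Vert x) (Vert y)"

lemma bisim_stepD:
  "bisim (Vert x) (Vert y) \<Longrightarrow> step x a x' \<Longrightarrow> \<exists>y'. step y a y' \<and> bisim x' y'"
  "bisim (Vert x) (Vert y) \<Longrightarrow> step y a y' \<Longrightarrow> \<exists>x'. step x a x' \<and> bisim x' y'"
  by (auto elim: bisim.cases)

lemma bisim_Tick_iff: "bisim Tick y \<longleftrightarrow> y = Tick" "bisim x Tick \<longleftrightarrow> x = Tick"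
  by (auto elim: bisim.cases intro: bisim_Tick)

lemma bisim_refl: "bisim x x"
proof -
  have "u = v \<Longrightarrow> bisim u v" for u v :: "'a stexp node"
  proof (coinduction arbitrary: u v)
    case (bisim u v)
    then show ?case by (cases u) auto
  qed
  then show ?thesis by simp
qed

lemma bisim_sym: "bisim x y \<Longrightarrow> bisim y x"
proof (coinduction arbitrary: x y)
  case (bisim x y)
  show ?case
  proof (cases x)
    case Tick
    then show ?thesis using bisim by (simp add: bisim_Tick_iff)
  next
    case (Vert x')
    then obtain y' where y: "y = Vert y'" using bisim by (cases y) (auto simp: bisim_Tick_iff)
    note steps = bisim_stepD[OF bisim[unfolded Vert y]]
    have "\<exists>v. step x' a v \<and> bisim v u" if "step y' a u" for a u
      using steps(2)[OF that] .
    moreover have "\<exists>u. step y' a u \<and> bisim v u" if "step x' a v" for a v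
      using steps(1)[OF that] .
    ultimately show ?thesis unfolding Vert y by simp meson
  qed
qed

lemma bisim_trans: "bisim x y \<Longrightarrow> bisim y z \<Longrightarrow> bisim x z"
proof (coinduction arbitrary: x y z)
  case (bisim x y z)
  show ?case
  proof (cases x)
    case Tick
    then show ?thesis using bisim by (simp add: bisim_Tick_iff)
  next
    case (Vert x')
    then obtain y' where y: "y = Vert y'" using bisim(1) by (cases y) (auto simp: bisim_Tick_iff)
    then obtain z' where z: "z = Vert z'" using bisim(2) by (cases z) (auto simp: bisim_Tick_iff)
    note steps = bisim_stepD[OF bisim(1)[unfolded Vert y]] bisim_stepD[OF bisim(2)[unfolded y z]]
    have "\<exists>v. step z' a v \<and> (\<exists>w. bisim u w \<and> bisim w v)" if "step x' a u" for a u
      using steps(1)[OF that] steps(3) by blast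
    moreover have "\<exists>u. step x' a u \<and> (\<exists>w. bisim u w \<and> bisim w v)" if "step z' a v" for a v
      using steps(4)[OF that] steps(2) by blast
    ultimately show ?thesis unfolding Vert z by simp meson
  qed
qed

text \<open>The given bisimulation relates only reachable vertices, where chart transitions and
  steps agree, so it serves as coinduction witness.\<close>

lemma bisim_chart_of:
  assumes "bisimilar (chart_of A e1) (chart_of A e2)"
  shows "bisim (Vert e1) (Vert e2)"
proof -
  obtain B where B: "bisimulation (chart_of A e1) (chart_of A e2) B"
    using assms by (auto simp: bisimilar_def)
  have sub: "B \<subseteq> reach e1 \<times> reach e2"
    using B by (simp add: bisimulation_def chart_of_def)
  have B_step: "(\<forall>a u'. (u, a, u') \<in> transitions (chart_of A e1) \<longrightarrow>
        (\<exists>v'. (v, a, v') \<in> transitions (chart_of A e2) \<and> (u', v') \<in> B)) \<and>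
      (\<forall>a v'. (v, a, v') \<in> transitions (chart_of A e2) \<longrightarrow>
        (\<exists>u'. (u, a, u') \<in> transitions (chart_of A e1) \<and> (u', v') \<in> B)) \<and>
      (u = Tick \<longleftrightarrow> v = Tick)" if "(u, v) \<in> B" for u v
    using B that unfolding bisimulation_def by (elim conjE) (drule (1) bspec, unfold prod.case)
  have trans: "(Vert x, a, x') \<in> transitions (chart_of A e) \<longleftrightarrow> step x a x'"
    if "Vert x \<in> reach e" for x a x' e
    using that by (simp add: chart_of_def step_rel_def)
  have "(u, v) \<in> B \<Longrightarrow> bisim u v" for u v
  proof (coinduction arbitrary: u v)
    case (bisim u v)
    show ?case
    proof (cases u)
      case Tick
      then show ?thesis using B_step[OF bisim] by simp
    next
      case (Vert x)
      then obtain y where y: "v = Vert y" using B_step[OF bisim] by (cases v) auto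
      then have "Vert x \<in> reach e1" "Vert y \<in> reach e2" using bisim sub Vert by auto
      then show ?thesis using B_step[OF bisim] by (simp add: Vert y trans) blast
    qed
  qed
  moreover have "(Vert e1, Vert e2) \<in> B"
    using B by (simp add: bisimulation_def chart_of_def)
  ultimately show ?thesis by blast
qed

text \<open>Bisimulation collapse: \<open>h\<close> picks one representative in \<open>V\<close> of
  each class. An edge of the image out of \<open>h x\<close> stems from some \<open>x0\<close> in
  the class of \<open>x\<close>, and \<open>x\<close> can match it.\<close>

lemma step_graph_quotient:
  fixes V :: "'a stexp set"
  assumes closed: "\<forall>x\<in>V. \<forall>a y. step x a (Vert y) \<longrightarrow> y \<in> V"
  shows "\<exists>h :: 'a stexp \<Rightarrow> 'a stexp.
    functional_bisim h (step_graph V) ((\<lambda>(x, a, y). (h x, a, map_node h y)) ` step_graph V) \<and>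
    (\<forall>x\<in>V. \<forall>y\<in>V. bisim (Vert x) (Vert y) \<longrightarrow> h x = h y)"
proof -
  define h where "h x = (if x \<in> V then SOME y. y \<in> V \<and> bisim (Vert x) (Vert y) else x)" for x
  define H where "H = (\<lambda>(x, a, y). (h x, a, map_node h y)) ` step_graph V"
  have h: "h x \<in> V \<and> bisim (Vert x) (Vert (h x))" if "x \<in> V" for x
  proof -
    have "x \<in> V \<and> bisim (Vert x) (Vert x)" using that bisim_refl by blast
    then show ?thesis using that unfolding h_def by (auto intro: someI2)
  qed
  have h_eq: "h x = h y" if "x \<in> V" "y \<in> V" "bisim (Vert x) (Vert y)" for x y
  proof -
    have "bisim (Vert x) z \<longleftrightarrow> bisim (Vert y) z" for z
      using that(3) bisim_sym bisim_trans by blast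
    then show ?thesis using that by (simp add: h_def)
  qed
  have "\<exists>y. (x, a, y) \<in> step_graph V \<and> map_node h y = z" if edge: "(h x, a, z) \<in> H" for x a z
  proof -
    obtain x0 y0 where "(x0, a, y0) \<in> step_graph V" "h x = h x0" "z = map_node h y0"
      using edge unfolding H_def by auto
    then have x0: "x0 \<in> V" "step x0 a y0" "h x = h x0" "z = map_node h y0"
      by (simp_all add: step_graph_def)
    \<comment> \<open>Otherwise \<open>h x = x\<close> would lie outside \<open>V\<close>, whereas
      \<open>h x0\<close> lies in \<open>V\<close>.\<close>
    have "x \<in> V" using h[OF x0(1)] x0(3) by (metis h_def)
    then have "bisim (Vert x0) (Vert x)"
      using h[OF x0(1)] h[of x] x0(3) by (metis bisim_sym bisim_trans)
    then have "\<exists>y. step x a y \<and> bisim y0 y" using x0(2) by (rule bisim_stepD)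
    then obtain y where y: "step x a y" "bisim y0 y" by blast
    have "map_node h y = map_node h y0"
    proof (cases y0)
      case Tick
      then show ?thesis using y(2) by (simp add: bisim_Tick_iff)
    next
      case (Vert v0)
      then obtain v where "y = Vert v" using y(2) by (cases y) (auto simp: bisim_Tick_iff)
      then show ?thesis
        using Vert y x0 \<open>x \<in> V\<close> closed h_eq[of v0 v] by auto
    qed
    then show ?thesis using y(1) x0(4) \<open>x \<in> V\<close> by (auto simp: step_graph_def)
  qed
  then have "functional_bisim h (step_graph V) H"
    unfolding functional_bisim_def by (force simp: H_def)
  then show ?thesis unfolding H_def using h_eq by (intro exI[of _ h]) simp
qed

text \<open>Edges of \<open>x\<close> and \<open>h x\<close> correspond, so both vertices have
  literally the same set of summands.\<close>

lemma solves_pullback: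
  assumes "functional_bisim h G H" "solves A (\<lambda>_. R) H s (h x)"
  shows "solves A (\<lambda>_. R) G (s \<circ> h) x"
proof -
  have "summand (s \<circ> h) a y = summand s a (map_node h y)" for a y
    by (cases y) auto
  then have "summands (s \<circ> h) G x = summands s H (h x)"
    using assms(1) unfolding functional_bisim_def summands_def
    by (simp only:) blast
  then show ?thesis using assms(2) by (simp add: solves_def)
qed

text \<open>Inside \<open>V\<close> this is \<open>BBP_fundamental\<close>. Vertices outside
  \<open>V\<close> have no edges, and the default \<open>Zero\<close> solves the equation with the
  empty sum.\<close>

lemma solves_identity:
  assumes "finite V" "V \<subseteq> StExp A" and closed: "\<forall>x\<in>V. \<forall>a y. step x a (Vert y) \<longrightarrow> y \<in> V"
  shows "solves A (\<lambda>_. Zero) (step_graph V) (\<lambda>x. if x \<in> V then x else Zero) x"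
proof (cases "x \<in> V")
  case True
  have in_V: "summand (\<lambda>x. if x \<in> V then x else Zero) a y = summand (\<lambda>x. x) a y" if "step x a y" for a y
    using that True closed by (cases y) auto
  then have sums: "summands (\<lambda>x. if x \<in> V then x else Zero) (step_graph V) x =
      {summand (\<lambda>x. x) a y | a y. step x a y}"
    by (simp add: summands_def step_graph_def True in_V cong: rev_conj_cong)
  have eq: "BBP A x (ssum {summand (\<lambda>x. x) a y | a y. step x a y})"
    using True assms(2) by (intro BBP_fundamental) auto
  also have "BBP A (ssum {summand (\<lambda>x. x) a y | a y. step x a y})
      (Zero \<star> ssum {summand (\<lambda>x. x) a y | a y. step x a y})"
    using BBP_StExp[OF eq] by (intro BBP_Zero_Star) simp
  finally have "BBP A x (Zero \<star> ssum {summand (\<lambda>x. x) a y | a y. step x a y})" .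
  then show ?thesis using True unfolding solves_def sums by simp
next
  case False
  then have "summands s (step_graph V) x = {}" for s
    by (simp add: summands_def step_graph_def)
  moreover have "BBP A Zero (Zero \<star> ssum {})"
    using BBP.Trans[OF BBP.Sym[OF ssum_empty] BBP_Zero_Star]
    by (simp add: ssum_StExp)
  ultimately show ?thesis using False by (simp add: solves_def)
qed

theorem theorem7p1:
  fixes A :: "'a set" and e1 e2 :: "'a stexp"
  assumes "e1 \<in> StExp A" and "e2 \<in> StExp A"
    and "bisimilar (chart_of A e1) (chart_of A e2)"
  shows "BBP A e1 e2"
proof -
  \<comment> \<open>Both charts form one graph, so that a single collapse identifies bisimilar
    vertices across them.\<close>
  define V where "V = {x. Vert x \<in> reach e1 \<union> reach e2}"
  let ?G = "step_graph V"
  have V: "V \<subseteq> StExp A"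
    using reach_StExp[OF assms(1)] reach_StExp[OF assms(2)] by (auto simp: V_def)
  have "finite V"
  proof -
    have "Vert ` V \<subseteq> reach e1 \<union> reach e2" by (auto simp: V_def)
    then have "finite (Vert ` V)" by (rule finite_subset) (simp add: finite_reach)
    then show ?thesis by (rule finite_imageD) (simp add: inj_on_def)
  qed
  have closed: "\<forall>x\<in>V. \<forall>a y. step x a (Vert y) \<longrightarrow> y \<in> V"
    by (auto simp: V_def intro: reach_step)
  have e12: "e1 \<in> V" "e2 \<in> V" by (auto simp: V_def reach_refl)
  obtain h :: "'a stexp \<Rightarrow> 'a stexp" where h: "functional_bisim h ?G ((\<lambda>(x, a, y). (h x, a, map_node h y)) ` ?G)"
      (is "functional_bisim h ?G ?H")
    and h_eq: "\<forall>x\<in>V. \<forall>y\<in>V. bisim (Vert x) (Vert y) \<longrightarrow> h x = h y"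
    using step_graph_quotient[OF closed] by blast
  have G: "graph_over A ?G"
    unfolding graph_over_def
  proof (intro conjI allI impI)
    show "finite ?G" using \<open>finite V\<close> by (rule finite_step_graph)
    fix x a y assume "(x, a, y) \<in> ?G"
    then have "x \<in> V" "step x a y" by (simp_all add: step_graph_def)
    then show "a \<in> A" using step_StExp[OF _ subsetD[OF V]] by simp
  qed
  then have "graph_over A ?H" by (auto simp: graph_over_def)
  have LEE: "LEE ?G" using \<open>finite V\<close> by (rule LEE_step_graph)
  then have "LEE ?H" using h by (rule LEE_image[OF _ order_refl])
  then obtain s where "\<And>x. solves A (\<lambda>_. Zero) ?H s x"
    using LEE_unique_solution[OF _ \<open>graph_over A ?H\<close>, of "\<lambda>_. Zero"] by auto
  then have s: "solves A (\<lambda>_. Zero) ?G (s \<circ> h) x" for x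
    using solves_pullback[OF h, of A Zero s x] by simp
  \<comment> \<open>Uniqueness on \<open>?G\<close>: the identity and the pulled-back solution are
    both provably equal to \<open>t\<close>.\<close>
  have solution: "BBP A x (s (h x))" if "x \<in> V" for x
  proof -
    obtain t where "\<forall>s'. (\<forall>x. solves A (\<lambda>_. Zero) ?G s' x) \<longrightarrow> (\<forall>x. BBP A (s' x) (t x))"
      using LEE_unique_solution[OF LEE G, of "\<lambda>_. Zero"] by auto
    then have t: "BBP A (s' x) (t x)" if "\<And>x. solves A (\<lambda>_. Zero) ?G s' x" for s' x
      using that by simp
    have "BBP A x (t x)"
      using t[OF solves_identity[OF \<open>finite V\<close> V closed], of x] that by simp
    also have "BBP A (t x) (s (h x))"
      using BBP.Sym[OF t[OF s, of x]] by simp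
    finally show ?thesis .
  qed
  have "h e1 = h e2"
    using h_eq e12 bisim_chart_of[OF assms(3)] by simp
  then have "BBP A (s (h e1)) e2"
    using BBP.Sym[OF solution[OF e12(2)]] by simp
  with solution[OF e12(1)] show ?thesis by (rule BBP.Trans)
qed

end
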